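(* Let $0<\alpha<1$. For every positive integer $N$ and every real vector $(v^1,v^2,\ldots,v^N)\in\mathbb{R}^{N}$, $$\sum_{n=1}^{N}\sum_{k=1}^{n}c_{n-k}^{(n,\alpha)}\,v^k v^n\ \ge\ 0 .$$
   Context: Superscripts on $v$ are indices, not powers. Put $a_0^{(\alpha)}=(\tfrac12)^{1-\alpha}$ and, for $k\ge1$, $$a_k^{(\alpha)}=(k+\tfrac12)^{1-\alpha}-(k-\tfrac12)^{1-\alpha},$$ $$b_k^{(\alpha)}=\tfrac{1}{2-\alpha}\big[(k+\tfrac12)^{2-\alpha}-(k-\tfrac12)^{2-\alpha}\big]-\tfrac12\big[(k+\tfrac12)^{1-\alpha}+(k-\tfrac12)^{1-\alpha}\big].$$ For $n=1$: $c_0^{(1,\alpha)}=a_0^{(\alpha)}$. For $n\ge2$: $c_0^{(n,\alpha)}=a_0^{(\alpha)}+b_1^{(\alpha)}$; $c_k^{(n,\alpha)}=a_k^{(\alpha)}+b_{k+1}^{(\alpha)}-b_k^{(\alpha)}$ for $1\le k\le n-2$; $c_{n-1}^{(n,\alpha)}=a_{n-1}^{(\alpha)}-b_{n-1}^{(\alpha)}$. *)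

theory Defs
  imports Complex_Main
begin

definition a_coeff :: "real \<Rightarrow> nat \<Rightarrow> real" where
  "a_coeff \<alpha> k =
    (if k = 0 then (1/2) powr (1 - \<alpha>)
     else (real k + 1/2) powr (1 - \<alpha>) - (real k - 1/2) powr (1 - \<alpha>))"

text \<open>Only the values for \<open>k \<ge> 1\<close> are meaningful.\<close>

definition b_coeff :: "real \<Rightarrow> nat \<Rightarrow> real" where
  "b_coeff \<alpha> k =
    1 / (2 - \<alpha>) * ((real k + 1/2) powr (2 - \<alpha>) - (real k - 1/2) powr (2 - \<alpha>))
    - 1/2 * ((real k + 1/2) powr (1 - \<alpha>) + (real k - 1/2) powr (1 - \<alpha>))"

text \<open>\<open>c_coeff \<alpha> n k\<close> is $c_k^{(n,\alpha)}$, meaningful only for \<open>k < n\<close>.\<close>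

definition c_coeff :: "real \<Rightarrow> nat \<Rightarrow> nat \<Rightarrow> real" where
  "c_coeff \<alpha> n k =
    (if n = 1 then a_coeff \<alpha> 0
     else if k = 0 then a_coeff \<alpha> 0 + b_coeff \<alpha> 1
     else if k \<le> n - 2 then a_coeff \<alpha> k + b_coeff \<alpha> (k + 1) - b_coeff \<alpha> k
     else a_coeff \<alpha> (n - 1) - b_coeff \<alpha> (n - 1))"

end

(*
Write the sum as half the quadratic form of a symmetric matrix whose lower triangle M n k is
c_coeff n (n - k), with doubled diagonal. With M n 0 = 0, Abel summation in k and then in n
expresses such a form as a combination of squares of the block sums v i + ... + v n, with weights
the mixed differences of M; so it suffices that M n i - M n (i - 1) is nonnegative and decreasing in n.
Away from the first column M is Toeplitz. With P x = x powr (2 - alpha) / (2 - alpha) and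
Q = P - P'/2, its k-th entry is the second difference of Q at k - 1/2 for k >= 1, so monotonicity
and convexity in k come from the signs of the third and fourth derivatives of Q; at the diagonal convexity
is a one-variable inequality in alpha. The first column deviates by -b_coeff n, which is controlled by
the trapezoid rule: b_coeff is its error for P', its derivative the error for P''.
*)
theory Submission
  imports Defs
begin

section \<open>Abel summation for quadratic forms\<close>

lemma quadratic_form_nonneg:
  fixes M :: "nat \<Rightarrow> nat \<Rightarrow> real" and v :: "nat \<Rightarrow> real"
  assumes zero: "\<And>n. M n 0 = 0"
    and mono: "\<And>n i. 1 \<le> i \<Longrightarrow> i \<le> n \<Longrightarrow> M n (i - 1) \<le> M n i"
    and mixed: "\<And>n i. 1 \<le> i \<Longrightarrow> i \<le> n \<Longrightarrow>
      M (Suc n) i - M (Suc n) (i - 1) \<le> M n i - M n (i - 1)"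
  shows "0 \<le> (\<Sum>n = 1..N. M n n * (v n)\<^sup>2 + 2 * (\<Sum>k = 1..<n. M n k * v k * v n))"
proof -
  define r where "r n i = M n i - M n (i - 1)" for n i
  \<comment> \<open>The half-open range gives \<open>S n n = 0\<close> and, for
    \<open>i \<le> n\<close>, \<open>S i (Suc n) = S i n + v n\<close>.\<close>
  define S where "S i n = (\<Sum>k = i..<n. v k)" for i n
  have M_eq: "(\<Sum>i = 1..k. r n i) = M n k" for n k
    by (induction k) (auto simp: r_def zero)
  \<comment> \<open>Each difference of squares is \<open>v n * v n + 2 * v n * S i n\<close>;
    weighting by \<open>r n i\<close> and swapping the sums rebuilds the entries of
    \<open>M\<close>.\<close>
  have row: "M n n * (v n)\<^sup>2 + 2 * (\<Sum>k = 1..<n. M n k * v k * v n)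
      = (\<Sum>i = 1..n. r n i * ((S i (Suc n))\<^sup>2 - (S i n)\<^sup>2))" for n
  proof -
    have "(\<Sum>i = 1..n. r n i * S i n) = (\<Sum>i = 1..n. \<Sum>k\<in>{k \<in> {1..<n}. i \<le> k}. r n i * v k)"
      by (intro sum.cong refl) (auto simp: S_def sum_distrib_left intro!: sum.cong)
    also have "\<dots> = (\<Sum>k = 1..<n. \<Sum>i\<in>{i \<in> {1..n}. i \<le> k}. r n i * v k)"
      by (rule sum.swap_restrict) auto
    also have "\<dots> = (\<Sum>k = 1..<n. (\<Sum>i = 1..k. r n i) * v k)"
      unfolding sum_distrib_right by (intro sum.cong refl) auto
    finally have inner: "(\<Sum>i = 1..n. r n i * S i n) = (\<Sum>k = 1..<n. M n k * v k)"
      unfolding M_eq .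
    have "(\<Sum>i = 1..n. r n i * ((S i (Suc n))\<^sup>2 - (S i n)\<^sup>2))
        = (\<Sum>i = 1..n. (v n)\<^sup>2 * r n i + 2 * v n * (r n i * S i n))"
      by (intro sum.cong refl) (auto simp: S_def power2_eq_square algebra_simps)
    also have "\<dots> = (v n)\<^sup>2 * M n n + 2 * v n * (\<Sum>k = 1..<n. M n k * v k)"
      unfolding sum.distrib sum_distrib_left[symmetric] inner M_eq ..
    finally show ?thesis
      by (simp add: sum_distrib_left sum_distrib_right mult_ac)
  qed
  \<comment> \<open>Bare nonnegativity would not survive the induction: the squares kept here absorb
    the negative squares of the next row, since by \<open>mixed\<close> the weights only
    decrease.\<close>
  have "(\<Sum>i = 1..N. r N i * (S i (Suc N))\<^sup>2)
      \<le> (\<Sum>n = 1..N. M n n * (v n)\<^sup>2 + 2 * (\<Sum>k = 1..<n. M n k * v k * v n))"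
  proof (induction N)
    case 0
    then show ?case by simp
  next
    case (Suc N)
    have "(\<Sum>i = 1..N. r (Suc N) i * (S i (Suc N))\<^sup>2) \<le> (\<Sum>i = 1..N. r N i * (S i (Suc N))\<^sup>2)"
      by (intro sum_mono mult_right_mono) (auto simp: r_def mixed[simplified])
    moreover have "S (Suc N) (Suc N) = 0"
      by (simp add: S_def)
    ultimately show ?case
      using Suc.IH row[of "Suc N"] by (simp add: right_diff_distrib sum_subtractf)
  qed
  moreover have "0 \<le> (\<Sum>i = 1..N. r N i * (S i (Suc N))\<^sup>2)"
    by (intro sum_nonneg mult_nonneg_nonneg) (auto simp: r_def mono[simplified])
  ultimately show ?thesis by linarith
qed

section \<open>Finite differences and the trapezoid rule\<close>

definition fdiff :: "(real \<Rightarrow> real) \<Rightarrow> real \<Rightarrow> real" where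
  "fdiff F x = F (x + 1) - F x"

lemma fdiff_has_derivative:
  assumes "\<And>x. 0 < x \<Longrightarrow> (F has_real_derivative F' x) (at x)" and "0 < x"
  shows "(fdiff F has_real_derivative fdiff F' x) (at x)"
  unfolding fdiff_def using assms
  by (intro derivative_intros) (auto simp: DERIV_shift[symmetric])

lemma fdiff_nonneg:
  assumes F: "\<And>x. 0 < x \<Longrightarrow> (F has_real_derivative F' x) (at x)"
    and nonneg: "\<And>x. 0 < x \<Longrightarrow> 0 \<le> F' x" and "0 < x"
  shows "0 \<le> fdiff F x"
proof -
  have "F x \<le> F (x + 1)"
    using \<open>0 < x\<close> by (intro DERIV_nonneg_imp_nondecreasing[of x "x + 1" F])
      (auto intro!: exI[of _ "F' _"] F nonneg)
  then show ?thesis by (simp add: fdiff_def)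
qed

text \<open>Differencing commutes with differentiation, so the induction replaces the whole
  derivative chain \<open>F i\<close> by \<open>fdiff (F i)\<close>, which is why \<open>F\<close>
  stays arbitrary.\<close>

lemma iterated_fdiff_nonneg:
  assumes "\<And>i x. 0 < x \<Longrightarrow> (F i has_real_derivative F (Suc i) x) (at x)"
    and "\<And>x. 0 < x \<Longrightarrow> 0 \<le> F m x" and "0 < x"
  shows "0 \<le> (fdiff ^^ m) (F 0) x"
  using assms
proof (induction m arbitrary: F x)
  case 0
  then show ?case by simp
next
  case (Suc m)
  have "0 \<le> (fdiff ^^ m) (fdiff (F 0)) x"
    by (rule Suc.IH[of "\<lambda>i. fdiff (F i)"])
      (auto intro: fdiff_has_derivative fdiff_nonneg Suc.prems)
  then show ?case by (simp add: funpow_swap1)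
qed

text \<open>An increasing \<open>\<chi>\<close> makes \<open>\<phi>\<close> convex, and the
  trapezoid rule overestimates the integral of a convex function.\<close>

lemma fdiff_le_trapezoid:
  fixes F \<phi> \<chi> :: "real \<Rightarrow> real"
  assumes F: "\<And>x. 0 < x \<Longrightarrow> (F has_real_derivative \<phi> x) (at x)"
    and \<phi>: "\<And>x. 0 < x \<Longrightarrow> (\<phi> has_real_derivative \<chi> x) (at x)"
    and mono: "\<And>x y. 0 < x \<Longrightarrow> x \<le> y \<Longrightarrow> \<chi> x \<le> \<chi> y"
    and u: "0 < u"
  shows "fdiff F u \<le> (\<phi> u + \<phi> (u + 1)) / 2"
proof -
  define t where "t = u + 1/2"
  \<comment> \<open>Growing the interval symmetrically from its midpoint cancels the
    \<open>\<phi>\<close> terms in the derivative of \<open>K\<close>, leaving only a difference of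
    values of \<open>\<chi>\<close>.\<close>
  define K where "K h = F (t + h) - F (t - h) - h * (\<phi> (t + h) + \<phi> (t - h))" for h
  have "K (1/2) \<le> K 0"
  proof (rule DERIV_nonpos_imp_nonincreasing[of 0 "1/2" K])
    fix h :: real
    assume h: "0 \<le> h" "h \<le> 1/2"
    have pos: "0 < t + h" "0 < t - h" using h u by (auto simp: t_def)
    have shift: "((\<lambda>h. t + h) has_real_derivative 1) (at h)"
      "((\<lambda>h. t - h) has_real_derivative -1) (at h)"
      by (auto intro!: derivative_eq_intros)
    have c: "((\<lambda>h. F (t + h)) has_real_derivative \<phi> (t + h)) (at h)"
      "((\<lambda>h. F (t - h)) has_real_derivative - \<phi> (t - h)) (at h)"
      "((\<lambda>h. \<phi> (t + h)) has_real_derivative \<chi> (t + h)) (at h)"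
      "((\<lambda>h. \<phi> (t - h)) has_real_derivative - \<chi> (t - h)) (at h)"
      using DERIV_chain2[OF F[OF pos(1)] shift(1)] DERIV_chain2[OF F[OF pos(2)] shift(2)]
        DERIV_chain2[OF \<phi>[OF pos(1)] shift(1)] DERIV_chain2[OF \<phi>[OF pos(2)] shift(2)]
      by simp_all
    have "(K has_real_derivative - h * (\<chi> (t + h) - \<chi> (t - h))) (at h)"
      unfolding K_def by (rule derivative_eq_intros c refl)+ (simp add: algebra_simps)
    moreover have "- h * (\<chi> (t + h) - \<chi> (t - h)) \<le> 0"
      using h mono[OF pos(2), of "t + h"] by simp
    ultimately show "\<exists>y. (K has_real_derivative y) (at h) \<and> y \<le> 0" by blast
  qed simp
  then show ?thesis by (simp add: K_def t_def fdiff_def add.assoc)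
qed

section \<open>Powers, their derivatives and the Toeplitz entries\<close>

text \<open>The \<open>i\<close>-th derivative of \<open>x powr (2 - \<alpha>) / (2 - \<alpha>)\<close>.\<close>

definition pw :: "real \<Rightarrow> nat \<Rightarrow> real \<Rightarrow> real" where
  "pw \<alpha> i x = (\<Prod>j<i. 2 - \<alpha> - real j) / (2 - \<alpha>) * x powr (2 - \<alpha> - real i)"

lemma pw_has_derivative:
  "0 < x \<Longrightarrow> (pw \<alpha> i has_real_derivative pw \<alpha> (Suc i) x) (at x)"
  unfolding pw_def
  by (rule DERIV_cong[OF DERIV_cmult[OF has_real_derivative_powr]]) (simp_all add: diff_diff_eq add_ac)

lemma pw_deriv:
  assumes "0 < x"
  shows "(pw \<alpha> 0 has_real_derivative pw \<alpha> 1 x) (at x)"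
    and "(pw \<alpha> 1 has_real_derivative pw \<alpha> 2 x) (at x)"
    and "(pw \<alpha> 2 has_real_derivative pw \<alpha> 3 x) (at x)"
    and "(pw \<alpha> 3 has_real_derivative pw \<alpha> 4 x) (at x)"
  using pw_has_derivative[OF assms, of \<alpha> 0] pw_has_derivative[OF assms, of \<alpha> 1]
    pw_has_derivative[OF assms, of \<alpha> 2] pw_has_derivative[OF assms, of \<alpha> 3]
  by (simp_all add: eval_nat_numeral)

definition Q_deriv :: "real \<Rightarrow> nat \<Rightarrow> real \<Rightarrow> real" where
  "Q_deriv \<alpha> i x = pw \<alpha> i x - pw \<alpha> (Suc i) x / 2"

lemma Q_deriv_has_derivative:
  "0 < x \<Longrightarrow> (Q_deriv \<alpha> i has_real_derivative Q_deriv \<alpha> (Suc i) x) (at x)"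
  unfolding Q_deriv_def by (auto intro!: derivative_eq_intros pw_has_derivative)

text \<open>For \<open>n \<ge> 2\<close> and \<open>k \<le> n - 2\<close> this is
  \<open>c_coeff \<alpha> n k\<close>, with no dependence on \<open>n\<close>.\<close>

definition toep :: "real \<Rightarrow> nat \<Rightarrow> real" where
  "toep \<alpha> k = a_coeff \<alpha> k + b_coeff \<alpha> (Suc k) - (if k = 0 then 0 else b_coeff \<alpha> k)"

text \<open>Combines \<open>exp y \<ge> 1 + y\<close> with \<open>ln c \<ge> 1 - 1 / c\<close>, so
  that for rational \<open>c\<close> the bound has rational coefficients.\<close>

lemma powr_ge_tangent:
  fixes c x :: real
  assumes "0 < c" "0 \<le> x"
  shows "1 + x * (1 - 1 / c) \<le> c powr x"
proof -
  have "1 - 1 / c \<le> ln c"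
    using ln_le_minus_one[of "1 / c"] assms by (simp add: ln_div)
  then have "1 + x * (1 - 1 / c) \<le> 1 + x * ln c"
    using assms by (simp add: mult_left_mono)
  also have "\<dots> \<le> c powr x"
    using exp_ge_add_one_self[of "x * ln c"] assms by (simp add: powr_def)
  finally show ?thesis .
qed

context
  fixes \<alpha> :: real
  assumes \<alpha>: "0 < \<alpha>" "\<alpha> < 1"
begin

text \<open>Only the first two factors of the product, \<open>2 - \<alpha>\<close> and
  \<open>1 - \<alpha>\<close>, are positive; each later factor flips the sign.\<close>

lemma pw_signs:
  assumes "0 < x"
  shows "0 \<le> pw \<alpha> 1 x" "0 \<le> pw \<alpha> 2 x" "pw \<alpha> 3 x \<le> 0" "0 \<le> pw \<alpha> 4 x" "pw \<alpha> 5 x \<le> 0"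
proof -
  have *: "pw \<alpha> i x = (\<Prod>j<i. 2 - \<alpha> - real j) * (x powr (2 - \<alpha> - real i) / (2 - \<alpha>))" for i
    by (simp add: pw_def)
  have n: "0 \<le> x powr (2 - \<alpha> - real i) / (2 - \<alpha>)" for i
    using \<alpha> by simp
  define p where "p i = (\<Prod>j<i. 2 - \<alpha> - real j)" for i :: nat
  have p: "p 0 = 1" "\<And>i. p (Suc i) = p i * (2 - \<alpha> - real i)"
    by (simp_all add: p_def)
  have p1: "0 \<le> p 1"
    using \<alpha> p(2)[of 0] by (simp add: p(1))
  have p2: "0 \<le> p 2"
    using \<alpha> p1 p(2)[of 1] by (simp add: numeral_2_eq_2)
  have p3: "p 3 \<le> 0"
    using \<alpha> p2 p(2)[of 2] by (simp add: mult_nonneg_nonpos)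
  have p4: "0 \<le> p 4"
    using \<alpha> p3 p(2)[of 3] by (simp add: mult_nonpos_nonpos)
  have p5: "p 5 \<le> 0"
    using \<alpha> p4 p(2)[of 4] by (simp add: mult_nonneg_nonpos)
  from p1 p2 p3 p4 p5
  show "0 \<le> pw \<alpha> 1 x" "0 \<le> pw \<alpha> 2 x" "pw \<alpha> 3 x \<le> 0" "0 \<le> pw \<alpha> 4 x" "pw \<alpha> 5 x \<le> 0"
    by (simp_all only: * n p_def[symmetric] mult_nonneg_nonneg mult_nonpos_nonneg)
qed

lemma pw_mono:
  assumes "0 < x" "x \<le> y"
  shows "pw \<alpha> 1 x \<le> pw \<alpha> 1 y" "pw \<alpha> 2 y \<le> pw \<alpha> 2 x" "pw \<alpha> 3 x \<le> pw \<alpha> 3 y"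
proof -
  have pos: "0 < z" if "x \<le> z" for z
    using assms that by linarith
  show "pw \<alpha> 1 x \<le> pw \<alpha> 1 y"
    by (rule DERIV_nonneg_imp_nondecreasing[OF assms(2)]) (blast intro: pos pw_deriv pw_signs)
  show "pw \<alpha> 2 y \<le> pw \<alpha> 2 x"
    by (rule DERIV_nonpos_imp_nonincreasing[OF assms(2)]) (blast intro: pos pw_deriv pw_signs)
  show "pw \<alpha> 3 x \<le> pw \<alpha> 3 y"
    by (rule DERIV_nonneg_imp_nondecreasing[OF assms(2)]) (blast intro: pos pw_deriv pw_signs)
qed

lemma fdiff_pw_bounds:
  assumes "0 < u"
  shows "fdiff (pw \<alpha> 0) u \<le> pw \<alpha> 1 (u + 1)" "pw \<alpha> 2 (u + 1) \<le> fdiff (pw \<alpha> 1) u"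
proof -
  obtain z where "u < z" "z < u + 1" "fdiff (pw \<alpha> 0) u = pw \<alpha> 1 z"
    using MVT2[of u "u + 1" "pw \<alpha> 0" "pw \<alpha> 1"] pw_deriv(1) assms
    by (auto simp: fdiff_def)
  then show "fdiff (pw \<alpha> 0) u \<le> pw \<alpha> 1 (u + 1)"
    using pw_mono(1)[of z "u + 1"] assms by simp
  obtain z where "u < z" "z < u + 1" "fdiff (pw \<alpha> 1) u = pw \<alpha> 2 z"
    using MVT2[of u "u + 1" "pw \<alpha> 1" "pw \<alpha> 2"] pw_deriv(2) assms
    by (auto simp: fdiff_def)
  then show "pw \<alpha> 2 (u + 1) \<le> fdiff (pw \<alpha> 1) u"
    using pw_mono(2)[of z "u + 1"] assms by simp
qed

lemma pw_0: "pw \<alpha> 0 x = x powr (2 - \<alpha>) / (2 - \<alpha>)"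
  by (simp add: pw_def)

lemma pw_1: "pw \<alpha> 1 x = x powr (1 - \<alpha>)"
  using \<alpha> by (simp add: pw_def)

lemma a_coeff_pw: "a_coeff \<alpha> (Suc k) = fdiff (pw \<alpha> 1) (real k + 1/2)"
  by (simp add: a_coeff_def pw_1[simplified] fdiff_def add_ac)

section \<open>The trapezoid error and the first column\<close>

definition trapezoid_error :: "real \<Rightarrow> real" where
  "trapezoid_error u = fdiff (pw \<alpha> 0) u - (pw \<alpha> 1 u + pw \<alpha> 1 (u + 1)) / 2"

lemma b_coeff_pw: "b_coeff \<alpha> (Suc k) = trapezoid_error (real k + 1/2)"
  by (simp add: b_coeff_def pw_0 pw_1[simplified] fdiff_def trapezoid_error_def add_ac diff_divide_distrib)

definition trapezoid_error' :: "real \<Rightarrow> real" where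
  "trapezoid_error' u = fdiff (pw \<alpha> 1) u - (pw \<alpha> 2 u + pw \<alpha> 2 (u + 1)) / 2"

lemma trapezoid_error_has_derivative:
  assumes "0 < u"
  shows "(trapezoid_error has_real_derivative trapezoid_error' u) (at u)"
proof -
  have "((\<lambda>u. pw \<alpha> 1 (u + 1)) has_real_derivative pw \<alpha> 2 (u + 1)) (at u)"
    using pw_deriv(2)[of "u + 1"] assms by (simp add: DERIV_shift[symmetric])
  moreover have "(fdiff (pw \<alpha> 0) has_real_derivative fdiff (pw \<alpha> 1) u) (at u)"
    by (intro fdiff_has_derivative pw_deriv assms)
  moreover have "(pw \<alpha> 1 has_real_derivative pw \<alpha> 2 u) (at u)"
    using assms by (rule pw_deriv)
  ultimately show ?thesis
    unfolding trapezoid_error_def trapezoid_error'_def by (auto intro!: derivative_eq_intros)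
qed

text \<open>\<open>pw \<alpha> 1\<close> is concave, so the convex estimate is applied to the
  negated functions.\<close>

lemma trapezoid_error_nonneg:
  assumes "0 < u"
  shows "0 \<le> trapezoid_error u"
proof -
  have "fdiff (\<lambda>x. - pw \<alpha> 0 x) u \<le> (- pw \<alpha> 1 u + - pw \<alpha> 1 (u + 1)) / 2"
    by (rule fdiff_le_trapezoid[where \<chi> = "\<lambda>x. - pw \<alpha> 2 x"])
      (auto intro!: DERIV_minus pw_deriv pw_mono(2) assms simp del: One_nat_def)
  then show ?thesis by (simp add: trapezoid_error_def fdiff_def)
qed

text \<open>\<open>pw \<alpha> 2\<close> is convex because \<open>pw \<alpha> 3\<close>
  increases.\<close>

lemma trapezoid_error'_nonpos:
  assumes "0 < u"
  shows "trapezoid_error' u \<le> 0"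
proof -
  have "fdiff (pw \<alpha> 1) u \<le> (pw \<alpha> 2 u + pw \<alpha> 2 (u + 1)) / 2"
    by (rule fdiff_le_trapezoid[OF pw_deriv(2) pw_deriv(3) pw_mono(3) assms])
  then show ?thesis by (simp add: trapezoid_error'_def)
qed

lemma b_coeff_nonneg: "0 \<le> b_coeff \<alpha> (Suc k)"
  by (simp add: b_coeff_pw trapezoid_error_nonneg)

lemma b_coeff_antimono: "b_coeff \<alpha> (Suc (Suc k)) \<le> b_coeff \<alpha> (Suc k)"
proof -
  have "0 \<le> fdiff (\<lambda>u. - trapezoid_error u) (real k + 1/2)"
    by (rule fdiff_nonneg[where F' = "\<lambda>u. - trapezoid_error' u"])
      (auto intro!: derivative_intros trapezoid_error_has_derivative trapezoid_error'_nonpos)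
  then show ?thesis by (simp add: b_coeff_pw fdiff_def add_ac)
qed

text \<open>Bounding the integral in the trapezoid error by the right endpoint value leaves half the
  increment of the increasing function \<open>pw \<alpha> 1\<close>. These are the first-column
  entries from row 2 on.\<close>

lemma edge_nonneg: "0 \<le> a_coeff \<alpha> (Suc k) - b_coeff \<alpha> (Suc k)"
  using fdiff_pw_bounds(1)[of "real k + 1/2"] pw_mono(1)[of "real k + 1/2" "real k + 1/2 + 1"]
  by (simp add: a_coeff_pw b_coeff_pw trapezoid_error_def fdiff_def field_simps)

lemma edge_antimono:
  "a_coeff \<alpha> (Suc (Suc k)) - b_coeff \<alpha> (Suc (Suc k)) \<le> a_coeff \<alpha> (Suc k) - b_coeff \<alpha> (Suc k)"
proof -
  define y where "y = real k + 1/2"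
  have "0 \<le> fdiff (\<lambda>u. trapezoid_error u - fdiff (pw \<alpha> 1) u) y"
  proof (rule fdiff_nonneg[where F' = "\<lambda>u. trapezoid_error' u - fdiff (pw \<alpha> 2) u"])
    fix x :: real
    assume x: "0 < x"
    have "(fdiff (pw \<alpha> 1) has_real_derivative fdiff (pw \<alpha> 2) x) (at x)"
      by (rule fdiff_has_derivative[OF pw_deriv(2) x])
    then show "((\<lambda>u. trapezoid_error u - fdiff (pw \<alpha> 1) u) has_real_derivative trapezoid_error' x - fdiff (pw \<alpha> 2) x) (at x)"
      using x by (intro derivative_intros trapezoid_error_has_derivative)
    \<comment> \<open>The endpoint bound leaves half the decrease of \<open>pw \<alpha> 2\<close>
      from \<open>x\<close> to \<open>x + 1\<close>.\<close>
    show "0 \<le> trapezoid_error' x - fdiff (pw \<alpha> 2) x"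
      using fdiff_pw_bounds(2)[OF x] pw_mono(2)[of x "x + 1"] x
      by (simp add: trapezoid_error'_def fdiff_def field_simps)
  qed (simp add: y_def)
  then have "fdiff (pw \<alpha> 1) (y + 1) - trapezoid_error (y + 1) \<le> fdiff (pw \<alpha> 1) y - trapezoid_error y"
    unfolding fdiff_def[of "\<lambda>u. trapezoid_error u - fdiff (pw \<alpha> 1) u"] by linarith
  moreover have "real (Suc k) + 1/2 = y + 1"
    by (simp add: y_def)
  ultimately show ?thesis
    unfolding a_coeff_pw b_coeff_pw by (simp only: y_def)
qed

section \<open>Monotonicity and convexity of the Toeplitz entries\<close>

text \<open>The difference of trapezoid errors contains half of
  \<open>pw \<alpha> 1 y - pw \<alpha> 1 (y + 2)\<close>; adding the \<open>a_coeff\<close> term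
  turns this into minus half a second difference.\<close>

lemma toep_Suc: "toep \<alpha> (Suc k) = fdiff (fdiff (Q_deriv \<alpha> 0)) (real k + 1/2)"
proof -
  define y where "y = real k + 1/2"
  have "real (Suc k) + 1/2 = y + 1"
    by (simp add: y_def)
  then have "toep \<alpha> (Suc k) = fdiff (pw \<alpha> 1) y + trapezoid_error (y + 1) - trapezoid_error y"
    unfolding toep_def a_coeff_pw b_coeff_pw y_def by simp
  also have "\<dots> = fdiff (fdiff (Q_deriv \<alpha> 0)) y"
    unfolding trapezoid_error_def fdiff_def Q_deriv_def One_nat_def by argo
  finally show ?thesis by (simp only: y_def)
qed

text \<open>\<open>a_coeff \<alpha> 0\<close> subtracts no earlier power, so only a first difference
  arises. The derivative arguments for \<open>toep\<close> therefore start at index 1.\<close>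

lemma toep_0: "toep \<alpha> 0 = fdiff (Q_deriv \<alpha> 0) (1/2)"
proof -
  have "toep \<alpha> 0 = pw \<alpha> 1 (1/2) + trapezoid_error (1/2)"
    by (simp add: toep_def b_coeff_pw a_coeff_def pw_1[simplified])
  also have "\<dots> = fdiff (Q_deriv \<alpha> 0) (1/2)"
    unfolding trapezoid_error_def fdiff_def Q_deriv_def One_nat_def by argo
  finally show ?thesis .
qed

lemma toep_antimono: "toep \<alpha> (Suc (Suc k)) \<le> toep \<alpha> (Suc k)"
proof -
  have "0 \<le> (fdiff ^^ 3) (\<lambda>x. - Q_deriv \<alpha> 0 x) (real k + 1/2)"
  proof (rule iterated_fdiff_nonneg[of "\<lambda>i x. - Q_deriv \<alpha> i x"])
    show "0 \<le> - Q_deriv \<alpha> 3 x" if "0 < x" for x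
      using pw_signs(3,4)[OF that] by (simp add: Q_deriv_def)
  qed (auto intro: DERIV_minus Q_deriv_has_derivative)
  then show ?thesis
    by (simp add: toep_Suc eval_nat_numeral fdiff_def add_ac)
qed

lemma toep_convex: "2 * toep \<alpha> (Suc (Suc k)) \<le> toep \<alpha> (Suc k) + toep \<alpha> (Suc (Suc (Suc k)))"
proof -
  have "0 \<le> (fdiff ^^ 4) (Q_deriv \<alpha> 0) (real k + 1/2)"
  proof (rule iterated_fdiff_nonneg[of "Q_deriv \<alpha>"])
    show "0 \<le> Q_deriv \<alpha> 4 x" if "0 < x" for x
      using pw_signs(4,5)[OF that] by (simp add: Q_deriv_def)
  qed (auto intro: Q_deriv_has_derivative)
  then show ?thesis
    by (simp add: toep_Suc eval_nat_numeral fdiff_def add_ac)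
qed

text \<open>Pulling out \<open>x powr (1 - \<alpha>)\<close> at \<open>x = m / 2\<close> leaves a
  linear factor; the multiplier clears denominators.\<close>

lemma Q_deriv_half:
  "Q_deriv \<alpha> 0 (m / 2) * (2 * (2 - \<alpha>)) = (1/2) powr (1 - \<alpha>) * (m powr (1 - \<alpha>) * (m - 2 + \<alpha>))"
  if "0 < m"
proof -
  have "(m / 2) powr (2 - \<alpha>) = m / 2 * (m / 2) powr (1 - \<alpha>)"
    using that powr_mult_base[of "m/2" "1 - \<alpha>"] by simp
  moreover have "(m / 2) powr (1 - \<alpha>) = (1/2) powr (1 - \<alpha>) * m powr (1 - \<alpha>)"
    using that powr_mult[of "1/2" m "1 - \<alpha>"] by simp
  ultimately show ?thesis
    using \<alpha> by (simp add: Q_deriv_def pw_0 pw_1[simplified] field_simps)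
qed

text \<open>Convexity at the diagonal, where \<open>toep \<alpha> 0\<close> counts twice. It unfolds
  to the values of \<open>Q_deriv \<alpha> 0\<close> at 7/2, 5/2, 3/2, 1/2 with weights 1, -4, 7,
  -4.\<close>

lemma toep_convex_0: "2 * toep \<alpha> 1 \<le> 2 * toep \<alpha> 0 + toep \<alpha> 2"
proof -
  define q where "q m = m powr (1 - \<alpha>) * (m - 2 + \<alpha>)" for m :: real
  \<comment> \<open>Scaling by the power of 5 makes the \<open>m = 5\<close> term polynomial. The
    other powers then have positive coefficients, as the linear factor is negative at
    \<open>m = 1\<close>, so lower bounds suffice.\<close>
  have q_eq: "q m = 5 powr (1 - \<alpha>) * (m / 5 * (5 / m) powr \<alpha> * (m - 2 + \<alpha>))"
    if "0 < m" for m :: real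
    using that by (simp add: q_def powr_diff powr_divide field_simps)
  have seven: "7/5 * (1 - 2/5 * \<alpha>) * (5 + \<alpha>) \<le> 7/5 * (5/7) powr \<alpha> * (5 + \<alpha>)"
    using \<alpha> powr_ge_tangent[of "5/7" \<alpha>] by (intro mult_right_mono mult_left_mono) auto
  have three: "3/5 * (1 + 2/5 * \<alpha>) * (1 + \<alpha>) \<le> 3/5 * (5/3) powr \<alpha> * (1 + \<alpha>)"
    using \<alpha> powr_ge_tangent[of "5/3" \<alpha>] by (intro mult_right_mono mult_left_mono) auto
  have one: "1/5 * (1 + 4/5 * \<alpha>) * (1 - \<alpha>) \<le> 1/5 * 5 powr \<alpha> * (1 - \<alpha>)"
    using \<alpha> powr_ge_tangent[of 5 \<alpha>] by (intro mult_right_mono mult_left_mono) auto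
  \<comment> \<open>What remains after the tangent bounds; the constant terms 7 - 12 + 21/5 + 4/5
    cancel.\<close>
  have "0 \<le> 8/25 * \<alpha> + 12/25 * \<alpha>\<^sup>2"
    using \<alpha> by simp
  also have "\<dots> = 7/5 * (1 - 2/5 * \<alpha>) * (5 + \<alpha>) - 4 * (3 + \<alpha>)
      + 7 * (3/5 * (1 + 2/5 * \<alpha>) * (1 + \<alpha>)) + 4 * (1/5 * (1 + 4/5 * \<alpha>) * (1 - \<alpha>))"
    by (simp add: power2_eq_square field_simps)
  also have "\<dots> \<le> 7/5 * (5/7) powr \<alpha> * (5 + \<alpha>) - 4 * (3 + \<alpha>)
      + 7 * (3/5 * (5/3) powr \<alpha> * (1 + \<alpha>)) + 4 * (1/5 * 5 powr \<alpha> * (1 - \<alpha>))"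
    using seven three one by linarith
  finally have "0 \<le> 5 powr (1 - \<alpha>) * (7/5 * (5/7) powr \<alpha> * (5 + \<alpha>) - 4 * (3 + \<alpha>)
      + 7 * (3/5 * (5/3) powr \<alpha> * (1 + \<alpha>)) + 4 * (1/5 * 5 powr \<alpha> * (1 - \<alpha>)))"
    by simp
  also have "\<dots> = q 7 - 4 * q 5 + 7 * q 3 - 4 * q 1"
    using q_eq[of 7] q_eq[of 5] q_eq[of 3] q_eq[of 1] by (simp add: right_diff_distrib distrib_left)
  finally have "0 \<le> (1/2) powr (1 - \<alpha>) * (q 7 - 4 * q 5 + 7 * q 3 - 4 * q 1)"
    by simp
  also have "\<dots> = (Q_deriv \<alpha> 0 (7/2) - 4 * Q_deriv \<alpha> 0 (5/2) + 7 * Q_deriv \<alpha> 0 (3/2) - 4 * Q_deriv \<alpha> 0 (1/2))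
      * (2 * (2 - \<alpha>))"
    using Q_deriv_half[of 7] Q_deriv_half[of 5] Q_deriv_half[of 3] Q_deriv_half[of 1]
    unfolding q_def by (simp add: algebra_simps)
  finally have "0 \<le> Q_deriv \<alpha> 0 (7/2) - 4 * Q_deriv \<alpha> 0 (5/2) + 7 * Q_deriv \<alpha> 0 (3/2) - 4 * Q_deriv \<alpha> 0 (1/2)"
    using \<alpha> by (simp add: zero_le_mult_iff)
  then show ?thesis
    using toep_Suc[of 0] toep_Suc[of 1] by (simp add: toep_0 fdiff_def numeral_2_eq_2)
qed

section \<open>The coefficient matrix and its difference conditions\<close>

text \<open>Column 0 is the zero padding for Abel summation; the doubled diagonal makes the form
  twice the sum in question.\<close>

definition cmat :: "nat \<Rightarrow> nat \<Rightarrow> real" where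
  "cmat n k = (if k = 0 then 0 else if k = n then 2 * c_coeff \<alpha> n 0 else c_coeff \<alpha> n (n - k))"

definition toep2 :: "nat \<Rightarrow> real" where
  "toep2 d = (if d = 0 then 2 * toep \<alpha> 0 else toep \<alpha> d)"

lemma cmat_first: "cmat 1 1 = 2 * a_coeff \<alpha> 0"
  "cmat (Suc (Suc n)) 1 = a_coeff \<alpha> (Suc n) - b_coeff \<alpha> (Suc n)"
  by (simp_all add: cmat_def c_coeff_def)

text \<open>Measures the first column against the Toeplitz pattern, for comparison with column
  2.\<close>

lemma cmat_first_toep2: "cmat (Suc (Suc n)) 1 = toep2 (Suc n) - b_coeff \<alpha> (Suc (Suc n))"
  by (simp add: cmat_def c_coeff_def toep2_def toep_def)

lemma cmat_interior: "2 \<le> k \<Longrightarrow> k \<le> n \<Longrightarrow> cmat n k = toep2 (n - k)"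
  by (auto simp: cmat_def c_coeff_def toep2_def toep_def)

lemma toep2_convex: "2 * toep2 (Suc d) \<le> toep2 d + toep2 (Suc (Suc d))"
  using toep_convex_0 toep_convex[of "d - 1"] by (cases d) (auto simp: toep2_def numeral_2_eq_2)

text \<open>At \<open>d = 0\<close> this follows from convexity at the diagonal together with
  \<open>toep \<alpha> 2 \<le> toep \<alpha> 1\<close>.\<close>

lemma toep2_antimono: "toep2 (Suc d) \<le> toep2 d"
  using toep2_convex[of 0] toep_antimono[of 0] toep_antimono[of "d - 1"]
  by (cases d) (auto simp: toep2_def)

lemma cmat_mono:
  assumes "1 \<le> i" "i \<le> n"
  shows "cmat n (i - 1) \<le> cmat n i"
proof -
  consider "i = 1" "n = 1" | m where "i = 1" "n = Suc (Suc m)"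
    | m where "i = 2" "n = Suc (Suc m)" | "3 \<le> i"
    using assms by (metis One_nat_def Suc_1 Suc_le_D Suc_le_mono le_antisym not_less_eq_eq numeral_3_eq_3)
  then show ?thesis
  proof cases
    case 1
    then show ?thesis by (simp add: cmat_first[simplified] a_coeff_def) (simp add: cmat_def)
  next
    case (2 m)
    then show ?thesis using edge_nonneg[of m] by (simp add: cmat_first[simplified]) (simp add: cmat_def)
  next
    case (3 m)
    then show ?thesis using cmat_first_toep2[of m] cmat_interior[of 2 n] toep2_antimono[of m]
        b_coeff_nonneg[of "Suc m"] by simp
  next
    case 4
    then have "n - (i - 1) = Suc (n - i)" using assms by simp
    then show ?thesis
      using 4 assms cmat_interior[of i n] cmat_interior[of "i - 1" n] toep2_antimono[of "n - i"]
      by simp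
  qed
qed

text \<open>Column 1 needs its entries to decrease down the rows, columns from 3 on need convexity
  of \<open>toep2\<close>, and column 2 needs convexity plus the decrease of
  \<open>b_coeff\<close>.\<close>

lemma cmat_mixed:
  assumes "1 \<le> i" "i \<le> n"
  shows "cmat (Suc n) i - cmat (Suc n) (i - 1) \<le> cmat n i - cmat n (i - 1)"
proof -
  consider "i = 1" "n = 1" | m where "i = 1" "n = Suc (Suc m)"
    | m where "i = 2" "n = Suc (Suc m)" | "3 \<le> i"
    using assms by (metis One_nat_def Suc_1 Suc_le_D Suc_le_mono le_antisym not_less_eq_eq numeral_3_eq_3)
  then show ?thesis
  proof cases
    case 1
    \<comment> \<open>\<open>a_coeff \<alpha> 1\<close> is \<open>a_coeff \<alpha> 0\<close> times
      \<open>3 powr (1 - \<alpha>) - 1\<close>, a factor of at most 2.\<close>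
    have "(3::real) powr (1 - \<alpha>) \<le> 3 powr 1" using \<alpha> by (intro powr_mono) auto
    then have "a_coeff \<alpha> 1 \<le> 2 * a_coeff \<alpha> 0"
      using powr_mult[of "1/2" 3 "1 - \<alpha>"] mult_left_mono[of "3 powr (1 - \<alpha>)" 3 "(1/2) powr (1 - \<alpha>)"]
      by (simp add: a_coeff_def)
    then show ?thesis
      using 1 cmat_first(1) cmat_first(2)[of 0] b_coeff_nonneg[of 0]
      by simp (simp add: cmat_def)
  next
    case (2 m)
    then show ?thesis using cmat_first(2)[of m] cmat_first(2)[of "Suc m"] edge_antimono[of m]
      by simp (simp add: cmat_def)
  next
    case (3 m)
    then show ?thesis
      using cmat_first_toep2[of m] cmat_first_toep2[of "Suc m"] cmat_interior[of 2 n]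
        cmat_interior[of 2 "Suc n"] toep2_convex[of m] b_coeff_antimono[of "Suc m"]
      by simp
  next
    case 4
    then have "n - (i - 1) = Suc (n - i)" "Suc n - i = Suc (n - i)" "Suc n - (i - 1) = Suc (Suc (n - i))"
      "2 \<le> i - 1" "i - 1 \<le> n"
      using assms by simp_all
    then show ?thesis
      using 4 assms cmat_interior[of i n] cmat_interior[of "i - 1" n] toep2_convex[of "n - i"]
        cmat_interior[of i "Suc n"] cmat_interior[of "i - 1" "Suc n"]
      by simp
  qed
qed

end

theorem lemma3p4:
  fixes \<alpha> :: real and N :: nat and v :: "nat \<Rightarrow> real"
  assumes "0 < \<alpha>" and "\<alpha> < 1" and "N \<ge> 1"
  shows "(\<Sum>n = 1..N. \<Sum>k = 1..n. c_coeff \<alpha> n (n - k) * v k * v n) \<ge> 0"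
proof -
  note \<alpha> = assms(1,2)
  have "0 \<le> (\<Sum>n = 1..N. cmat \<alpha> n n * (v n)\<^sup>2 + 2 * (\<Sum>k = 1..<n. cmat \<alpha> n k * v k * v n))"
    by (rule quadratic_form_nonneg)
      (use cmat_mono[OF \<alpha>] cmat_mixed[OF \<alpha>] in \<open>auto simp: cmat_def[OF \<alpha>]\<close>)
  also have "\<dots> = (\<Sum>n = 1..N. 2 * (\<Sum>k = 1..n. c_coeff \<alpha> n (n - k) * v k * v n))"
  proof (rule sum.cong[OF refl])
    fix n
    assume "n \<in> {1..N}"
    then have "{1..n} = insert n {1..<n}" by auto
    moreover have "(\<Sum>k = 1..<n. cmat \<alpha> n k * v k * v n) = (\<Sum>k = 1..<n. c_coeff \<alpha> n (n - k) * v k * v n)"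
      by (intro sum.cong refl) (auto simp: cmat_def[OF \<alpha>])
    ultimately show "cmat \<alpha> n n * (v n)\<^sup>2 + 2 * (\<Sum>k = 1..<n. cmat \<alpha> n k * v k * v n)
        = 2 * (\<Sum>k = 1..n. c_coeff \<alpha> n (n - k) * v k * v n)"
      using \<open>n \<in> {1..N}\<close> by (simp add: cmat_def[OF \<alpha>] power2_eq_square algebra_simps)
  qed
  finally show ?thesis by (simp add: sum_distrib_left[symmetric])
qed

end
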